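(* Let $n\in\mathbb{N}$ and let $M$ be a (real) balanced magic square matrix of size $m\times m$, where $m=2n$ or $m=2n-1$. Then there is $N\in\{1,\dots,n\}$ such that $M^N$ is either trivial or not magic.
   Context: An $m\times m$ real matrix $M$ is a semimagic square of weight $w\in\mathbb{R}$ if each of its rows and columns sums to $mw$; it is magic (a magic square) if, in addition, each of its two diagonals sums to $mw$. It is balanced if $M_{ij}=M_{m+1-i,m+1-j}$ for all $i,j\in\{1,\dots,m\}$. An $m\times m$ magic square matrix is trivial if it is a multiple of the $m\times m$ matrix with all entries $1$. *)

theory Defs
  imports Complex_Main "Jordan_Normal_Form.Matrix"
begin

text \<open>Matrix indices run over \<open>0, \<dots>, m - 1\<close> here, so the reflection \<open>i \<mapsto> m + 1 - i\<close>
  of the indices \<open>1, \<dots>, m\<close> becomes \<open>i \<mapsto> m - 1 - i\<close>.\<close>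

definition semimagic_square :: "nat \<Rightarrow> real \<Rightarrow> real mat \<Rightarrow> bool" where
  "semimagic_square m w M \<longleftrightarrow>
     M \<in> carrier_mat m m \<and>
     (\<forall>i<m. (\<Sum>j<m. M $$ (i, j)) = real m * w) \<and>
     (\<forall>j<m. (\<Sum>i<m. M $$ (i, j)) = real m * w)"

definition magic_square_of_weight :: "nat \<Rightarrow> real \<Rightarrow> real mat \<Rightarrow> bool" where
  "magic_square_of_weight m w M \<longleftrightarrow>
     semimagic_square m w M \<and>
     (\<Sum>i<m. M $$ (i, i)) = real m * w \<and>
     (\<Sum>i<m. M $$ (i, m - 1 - i)) = real m * w"

definition magic_square :: "nat \<Rightarrow> real mat \<Rightarrow> bool" where
  "magic_square m M \<longleftrightarrow> (\<exists>w. magic_square_of_weight m w M)"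

definition balanced_mat :: "nat \<Rightarrow> real mat \<Rightarrow> bool" where
  "balanced_mat m M \<longleftrightarrow>
     M \<in> carrier_mat m m \<and>
     (\<forall>i<m. \<forall>j<m. M $$ (i, j) = M $$ (m - 1 - i, m - 1 - j))"

definition trivial_magic_square :: "nat \<Rightarrow> real mat \<Rightarrow> bool" where
  "trivial_magic_square m M \<longleftrightarrow>
     magic_square m M \<and> (\<exists>c. M = c \<cdot>\<^sub>m mat m m (\<lambda>_. 1))"

end

theory Submission
  imports Defs "Jordan_Normal_Form.Schur_Decomposition"
begin

text \<open>Suppose that \<open>M, M\<^sup>2, \<dots>, M\<^sup>n\<close> are all magic. Let \<open>w\<close> be the weight of \<open>M\<close> and \<open>J\<close> the
  all-ones matrix. Since \<open>M J = J M = m w J\<close>, the matrix \<open>P = M - w J\<close> kills \<open>J\<close>, and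
  \<open>P\<^sup>N = M\<^sup>N - v J\<close> where \<open>v\<close> is the weight of \<open>M\<^sup>N\<close> (\<open>semimagic_deflate_pow\<close>). The two
  diagonal conditions on \<open>M\<^sup>N\<close> therefore say that both diagonals of \<open>P\<^sup>N\<close> sum to zero, that is,
  \<open>tr (P\<^sup>N) = tr (P\<^sup>N F) = 0\<close>, where \<open>F\<close> is the permutation matrix of the reflection
  \<open>i \<mapsto> m - 1 - i\<close>.

  That \<open>M\<close> is balanced means that \<open>M\<close>, and with it \<open>P\<close>, commutes with \<open>F\<close>. So \<open>P\<close> preserves
  the spaces of symmetric and of antisymmetric vectors, which are the images of the projections
  \<open>(1 \<plusminus> F) / 2\<close>. Both have dimension at most \<open>n\<close>, and by the above the powers
  \<open>P, \<dots>, P\<^sup>n\<close> have trace zero on each of them. An \<open>n \<times> n\<close> matrix whose first \<open>n\<close>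
  powers have trace zero has only zero eigenvalues, by the usual argument on power sums, so its
  \<open>n\<close>-th power vanishes (\<open>nilpotent_if_traces_zero\<close>). Hence \<open>P\<^sup>n\<close> is zero on both spaces, so
  \<open>P\<^sup>n = 0\<close> (\<open>balanced_nilpotent_if_diagonals_zero\<close>) and \<open>M\<^sup>n = v J\<close> is trivial.

  To pass from \<open>P\<close> on an invariant subspace to an honest \<open>n \<times> n\<close> matrix, the projection is
  factored through dimension \<open>n\<close> as \<open>X Y\<close>, and \<open>Y P X\<close> serves as the restricted operator
  (\<open>pow_mult_zero_if_compressed_traces_zero\<close>).\<close>

section \<open>Nilpotency from vanishing traces\<close>

definition trace_mat :: "'a::comm_ring_1 mat \<Rightarrow> 'a" where
  "trace_mat A = (\<Sum>i<dim_row A. A $$ (i, i))"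

lemma index_mult_mat_sum:
  fixes A B :: "'a::comm_ring_1 mat"
  assumes "A \<in> carrier_mat r k" "B \<in> carrier_mat k s" "i < r" "j < s"
  shows "(A * B) $$ (i, j) = (\<Sum>l<k. A $$ (i, l) * B $$ (l, j))"
  using assms by (auto simp: scalar_prod_def atLeast0LessThan)

lemma trace_mat_mult_comm:
  fixes A B :: "'a::comm_ring_1 mat"
  assumes A: "A \<in> carrier_mat r k" and B: "B \<in> carrier_mat k r"
  shows "trace_mat (A * B) = trace_mat (B * A)"
proof -
  have "trace_mat (A * B) = (\<Sum>i<r. \<Sum>l<k. A $$ (i, l) * B $$ (l, i))"
    using A B index_mult_mat_sum[OF A B] by (simp add: trace_mat_def)
  also have "\<dots> = (\<Sum>l<k. \<Sum>i<r. B $$ (l, i) * A $$ (i, l))"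
    by (subst sum.swap) (simp add: mult.commute)
  also have "\<dots> = trace_mat (B * A)"
    using A B index_mult_mat_sum[OF B A] by (simp add: trace_mat_def)
  finally show ?thesis .
qed

lemma trace_mat_similar:
  fixes A B :: "'a::comm_ring_1 mat"
  assumes "similar_mat_wit A B P Q"
  shows "trace_mat A = trace_mat B"
proof -
  define n where "n = dim_row A"
  from similar_mat_witD[OF n_def assms] have
    B: "B \<in> carrier_mat n n" and P: "P \<in> carrier_mat n n" and Q: "Q \<in> carrier_mat n n"
    and QP: "Q * P = 1\<^sub>m n" and A: "A = P * B * Q" by auto
  have "trace_mat A = trace_mat (P * (B * Q))"
    using A assoc_mult_mat[OF P B Q] by simp
  also have "\<dots> = trace_mat ((B * Q) * P)"
    by (rule trace_mat_mult_comm[of _ n n]) (use P B Q in auto)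
  also have "\<dots> = trace_mat B"
    using assoc_mult_mat[OF B Q P] QP right_mult_one_mat[OF B] by simp
  finally show ?thesis .
qed

text \<open>The power sums combine to \<open>\<Sum>j<n. p (f j) = 0\<close> for every polynomial \<open>p\<close> of degree at most
  \<open>n\<close> without constant term. If \<open>f i \<noteq> 0\<close>, some such \<open>p\<close> vanishes at all values of \<open>f\<close>
  except \<open>f i\<close>, and the sum is then a nonzero multiple of \<open>p (f i)\<close>.\<close>

lemma power_sums_zero_imp_zero:
  fixes f :: "nat \<Rightarrow> 'a::field_char_0"
  assumes sums: "\<And>k. k \<in> {1..n} \<Longrightarrow> (\<Sum>i<n. f i ^ k) = 0" and "i < n"
  shows "f i = 0"
proof (rule ccontr)
  assume fi: "f i \<noteq> 0"
  define S where "S = f ` {..<n} - {0, f i}"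
  \<comment> \<open>The factor \<open>x\<close> removes the constant term, and leaving \<open>f i\<close> out of \<open>S\<close> pays for its degree.\<close>
  define p where "p = [:0, 1:] * (\<Prod>x\<in>S. [:- x, 1:])"
  have "finite S" by (simp add: S_def)
  have "S \<subset> f ` {..<n}" using \<open>i < n\<close> by (auto simp: S_def)
  then have "card S < card (f ` {..<n})" by (intro psubset_card_mono) auto
  then have "card S < n" using card_image_le[of "{..<n}" f] by simp
  moreover have "degree p \<le> 1 + card S"
    unfolding p_def
    by (rule order.trans[OF degree_mult_le])
      (use degree_prod_sum_le[OF \<open>finite S\<close>, of "\<lambda>x. [:- x, 1:]"] in auto)
  ultimately have deg: "degree p \<le> n" by simp
  have p0: "coeff p 0 = 0" by (simp add: p_def)
  have "poly p x = (\<Sum>k\<le>n. coeff p k * x ^ k)" for x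
    using arg_cong[OF poly_as_sum_of_monoms'[OF deg], of "\<lambda>q. poly q x"]
    by (simp add: poly_sum poly_monom)
  then have "(\<Sum>j<n. poly p (f j)) = (\<Sum>j<n. \<Sum>k\<le>n. coeff p k * f j ^ k)"
    by simp
  also have "\<dots> = (\<Sum>k\<le>n. coeff p k * (\<Sum>j<n. f j ^ k))"
    by (subst sum.swap) (simp add: sum_distrib_left)
  also have "\<dots> = 0"
  proof (rule sum.neutral, safe)
    fix k assume "k \<le> n"
    then show "coeff p k * (\<Sum>j<n. f j ^ k) = 0"
      using sums[of k] p0 by (cases "k = 0") auto
  qed
  finally have zero: "(\<Sum>j<n. poly p (f j)) = 0" .
  have vanish: "poly p (f j) = 0" if "j < n" "f j \<noteq> f i" for j
    using that \<open>finite S\<close> by (auto simp: p_def S_def poly_prod)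
  \<comment> \<open>In characteristic zero the multiplicity of the value \<open>f i\<close> cannot cancel \<open>p (f i)\<close>.\<close>
  have "(\<Sum>j<n. poly p (f j)) = (\<Sum>j\<in>{j. j < n \<and> f j = f i}. poly p (f i))"
    by (rule sum.mono_neutral_cong_right) (use vanish in auto)
  then have "of_nat (card {j. j < n \<and> f j = f i}) * poly p (f i) = 0"
    using zero by simp
  moreover have "card {j. j < n \<and> f j = f i} \<noteq> 0"
    using \<open>i < n\<close> by (subst card_0_eq) auto
  moreover have "poly p (f i) \<noteq> 0"
    using fi \<open>finite S\<close> by (auto simp: p_def poly_prod S_def)
  ultimately show False by simp
qed

lemma upper_triangular_pow:
  fixes B :: "'a::comm_ring_1 mat"
  assumes B: "B \<in> carrier_mat n n" and ut: "upper_triangular B"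
  shows "upper_triangular (B ^\<^sub>m k) \<and> (\<forall>i<n. (B ^\<^sub>m k) $$ (i, i) = B $$ (i, i) ^ k)"
proof (induction k)
  case 0
  show ?case using B by auto
next
  case (Suc k)
  have Bk: "B ^\<^sub>m k \<in> carrier_mat n n" using B by simp
  have low: "B $$ (i, j) = 0" "(B ^\<^sub>m k) $$ (i, j) = 0" if "j < i" "i < n" for i j
    using that Suc ut B Bk by (auto dest: upper_triangularD)
  have entry: "(B ^\<^sub>m Suc k) $$ (i, j) = (\<Sum>l<n. (B ^\<^sub>m k) $$ (i, l) * B $$ (l, j))"
    if "i < n" "j < n" for i j
    using index_mult_mat_sum[OF Bk B that] by simp
  have "(B ^\<^sub>m Suc k) $$ (i, j) = 0" if "j < i" "i < n" for i j
  proof -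
    have "(B ^\<^sub>m k) $$ (i, l) * B $$ (l, j) = 0" if "l < n" for l
      using low[of l i] low[of j l] \<open>j < i\<close> \<open>i < n\<close> that by (cases "l < i") auto
    then show ?thesis using entry[of i j] that by simp
  qed
  moreover have "(B ^\<^sub>m Suc k) $$ (i, i) = B $$ (i, i) ^ Suc k" if "i < n" for i
  proof -
    have "(\<Sum>l<n. (B ^\<^sub>m k) $$ (i, l) * B $$ (l, i))
        = (\<Sum>l\<in>{i}. (B ^\<^sub>m k) $$ (i, l) * B $$ (l, i))"
    proof (rule sum.mono_neutral_right)
      show "\<forall>l\<in>{..<n} - {i}. (B ^\<^sub>m k) $$ (i, l) * B $$ (l, i) = 0"
      proof
        fix l assume "l \<in> {..<n} - {i}"
        then show "(B ^\<^sub>m k) $$ (i, l) * B $$ (l, i) = 0"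
          using low[of l i] low[of i l] that by (cases "l < i") auto
      qed
    qed (use that in auto)
    then show ?thesis using entry[of i i] that Suc by (simp add: mult.commute)
  qed
  ultimately show ?case using B by (auto intro!: upper_triangularI)
qed

lemma strictly_upper_triangular_nilpotent:
  fixes B :: "'a::comm_ring_1 mat"
  assumes B: "B \<in> carrier_mat n n"
    and strict: "\<And>i j. i < n \<Longrightarrow> j \<le> i \<Longrightarrow> B $$ (i, j) = 0"
  shows "B ^\<^sub>m n = 0\<^sub>m n n"
proof -
  \<comment> \<open>Each factor moves the first possibly nonzero diagonal up by one.\<close>
  have "(B ^\<^sub>m k) $$ (i, j) = 0" if "i < n" "j < n" "j < i + k" for k i j
    using that
  proof (induction k arbitrary: i j)
    case 0
    then show ?case using B by auto
  next
    case (Suc k)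
    have Bk: "B ^\<^sub>m k \<in> carrier_mat n n" using B by simp
    have "(B ^\<^sub>m k) $$ (i, l) * B $$ (l, j) = 0" if "l < n" for l
      using Suc.IH[of i l] strict[of l j] Suc.prems that by (cases "l < i + k") auto
    then show ?case using index_mult_mat_sum[OF Bk B Suc.prems(1,2)] by simp
  qed
  then show ?thesis using B by (intro eq_matI) auto
qed

text \<open>Over the complex numbers the matrix can be brought into triangular form, where the trace of the
  \<open>k\<close>-th power is the \<open>k\<close>-th power sum of the diagonal. The diagonal therefore vanishes.\<close>

lemma nilpotent_if_traces_zero_complex:
  fixes A :: "complex mat"
  assumes A: "A \<in> carrier_mat n n"
    and traces: "\<And>k. k \<in> {1..n} \<Longrightarrow> trace_mat (A ^\<^sub>m k) = 0"
  shows "A ^\<^sub>m n = 0\<^sub>m n n"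
proof -
  obtain es where "char_poly A = (\<Prod>a\<leftarrow>es. [:- a, 1:])"
    using char_poly_factorized[OF A] by blast
  from schur_decomposition_exists[OF A this] obtain B where
    B: "B \<in> carrier_mat n n" and ut: "upper_triangular B" and "similar_mat A B" by blast
  then obtain P Q where wit: "similar_mat_wit A B P Q" by (auto simp: similar_mat_def)
  have "(\<Sum>i<n. B $$ (i, i) ^ k) = 0" if "k \<in> {1..n}" for k
    using trace_mat_similar[OF similar_mat_wit_pow[OF wit, of k]] traces[OF that]
      upper_triangular_pow[OF B ut, of k] B by (simp add: trace_mat_def)
  then have "B $$ (i, i) = 0" if "i < n" for i
    using that by (rule power_sums_zero_imp_zero)
  then have "B $$ (i, j) = 0" if "i < n" "j \<le> i" for i j
    using upper_triangularD[OF ut, of j i] B that by (cases "j = i") auto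
  then have "B ^\<^sub>m n = 0\<^sub>m n n"
    by (rule strictly_upper_triangular_nilpotent[OF B])
  then show ?thesis
    using similar_mat_wit_pow_id[OF wit, of n] similar_mat_witD2[OF A wit] by simp
qed

lemma nilpotent_if_traces_zero:
  fixes A :: "real mat"
  assumes A: "A \<in> carrier_mat n n"
    and traces: "\<And>k. k \<in> {1..n} \<Longrightarrow> trace_mat (A ^\<^sub>m k) = 0"
  shows "A ^\<^sub>m n = 0\<^sub>m n n"
proof -
  let ?A = "map_mat complex_of_real A"
  have pow: "?A ^\<^sub>m k = map_mat complex_of_real (A ^\<^sub>m k)" for k
    by (rule of_real_hom.mat_hom_pow[OF A, symmetric])
  have "trace_mat (?A ^\<^sub>m k) = complex_of_real (trace_mat (A ^\<^sub>m k))" for k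
    unfolding pow using A by (simp add: trace_mat_def)
  then have "?A ^\<^sub>m n = 0\<^sub>m n n"
    using nilpotent_if_traces_zero_complex[of ?A n] A traces by simp
  then have "complex_of_real ((A ^\<^sub>m n) $$ (i, j)) = 0" if "i < n" "j < n" for i j
    using that A arg_cong[of _ _ "\<lambda>C. C $$ (i, j)"] unfolding pow
    by (metis carrier_matD index_map_mat(1) index_zero_mat(1) pow_carrier_mat)
  then show ?thesis using A by (intro eq_matI) auto
qed

text \<open>\<open>Q\<close> is a projection of rank at most \<open>n\<close> whose image is invariant under \<open>P\<close>. The
  compression \<open>A = Y P X\<close> satisfies \<open>X A\<^sup>k Y = P\<^sup>k Q\<close>, and by cyclicity of the trace
  \<open>tr (A\<^sup>k) = tr (P\<^sup>k Q)\<close> for \<open>k \<ge> 1\<close>, so the nilpotency of \<open>A\<close> transfers to \<open>P Q\<close>. That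
  \<open>n\<close> may exceed the rank of \<open>Q\<close> lets the symmetric and the antisymmetric part be treated alike
  although their dimensions differ when \<open>m\<close> is odd.\<close>

lemma pow_mult_zero_if_compressed_traces_zero:
  fixes P :: "real mat"
  assumes P: "P \<in> carrier_mat m m" and X: "X \<in> carrier_mat m n" and Y: "Y \<in> carrier_mat n m"
    and Q: "Q = X * Y" and idem: "Q * Q = Q" and comm: "P * Q = Q * P"
    and traces: "\<And>k. k \<in> {1..n} \<Longrightarrow> trace_mat (P ^\<^sub>m k * Q) = 0"
  shows "P ^\<^sub>m n * Q = 0\<^sub>m m m"
proof -
  define A where "A = Y * (P * X)"
  have QC: "Q \<in> carrier_mat m m" using Q X Y by simp
  have PX: "P * X \<in> carrier_mat m n" using P X by simp
  have A: "A \<in> carrier_mat n n" using A_def PX Y by simp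
  have Pk: "P ^\<^sub>m k \<in> carrier_mat m m" for k using P by simp
  have Ak: "A ^\<^sub>m k \<in> carrier_mat n n" for k using A by simp
  have lift: "X * A ^\<^sub>m k * Y = P ^\<^sub>m k * Q" for k
  proof (induction k)
    case 0
    show ?case using A P X QC Q by simp
  next
    case (Suc k)
    have XAk: "X * A ^\<^sub>m k \<in> carrier_mat m n" using X Ak by simp
    have "X * A ^\<^sub>m Suc k * Y = (X * A ^\<^sub>m k) * (Y * (P * X)) * Y"
      using assoc_mult_mat[OF X Ak A] by (simp add: A_def)
    also have "\<dots> = (X * A ^\<^sub>m k * Y) * ((P * X) * Y)"
      using assoc_mult_mat[OF XAk Y PX] assoc_mult_mat[OF _ PX Y, of "X * A ^\<^sub>m k * Y" m] XAk Y
      by simp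
    also have "(P * X) * Y = P * Q" using assoc_mult_mat[OF P X Y] Q by simp
    also have "(X * A ^\<^sub>m k * Y) * (P * Q) = P ^\<^sub>m k * (Q * (Q * P))"
      using Suc assoc_mult_mat[OF Pk QC, of "Q * P" m k] comm QC P by simp
    also have "Q * (Q * P) = Q * P" using assoc_mult_mat[OF QC QC P] idem by simp
    also have "P ^\<^sub>m k * (Q * P) = P ^\<^sub>m Suc k * Q"
      using assoc_mult_mat[OF Pk P QC] comm by simp
    finally show ?case .
  qed
  have "trace_mat (A ^\<^sub>m Suc k) = trace_mat (P ^\<^sub>m Suc k * Q)" for k
  proof -
    have AkY: "A ^\<^sub>m k * Y \<in> carrier_mat n m" by (rule mult_carrier_mat[OF Ak Y])
    have "A ^\<^sub>m Suc k = (A ^\<^sub>m k * Y) * P * X"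
      using assoc_mult_mat[OF Ak Y PX] assoc_mult_mat[OF AkY P X] by (simp add: A_def)
    then have "trace_mat (A ^\<^sub>m Suc k) = trace_mat (X * ((A ^\<^sub>m k * Y) * P))"
      using trace_mat_mult_comm[of "(A ^\<^sub>m k * Y) * P" n m X] AkY P X by simp
    also have "X * ((A ^\<^sub>m k * Y) * P) = P ^\<^sub>m k * Q * P"
      using assoc_mult_mat[OF X AkY P] assoc_mult_mat[OF X Ak Y] lift[of k] by simp
    also have "\<dots> = P ^\<^sub>m Suc k * Q"
      using assoc_mult_mat[OF Pk QC P] assoc_mult_mat[OF Pk P QC] comm by simp
    finally show ?thesis .
  qed
  then have "trace_mat (A ^\<^sub>m k) = 0" if "k \<in> {1..n}" for k
    using traces[OF that] that by (cases k) auto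
  then have "A ^\<^sub>m n = 0\<^sub>m n n" by (rule nilpotent_if_traces_zero[OF A])
  then show ?thesis using lift[of n] X Y by simp
qed

section \<open>Symmetric and antisymmetric parts under the reflection\<close>

text \<open>The matrix \<open>(1 + \<epsilon> F) / 2\<close>, with \<open>F\<close> the permutation matrix of \<open>i \<mapsto> m - 1 - i\<close>. For
  \<open>\<epsilon> = 1\<close> it projects onto the symmetric vectors, for \<open>\<epsilon> = - 1\<close> onto the antisymmetric ones.
  The two terms of an entry are added because both contribute at the centre of an odd square.\<close>

definition reflection_proj :: "nat \<Rightarrow> real \<Rightarrow> real mat" where
  "reflection_proj m \<epsilon> =
     mat m m (\<lambda>(i, j). ((if i = j then 1 else 0) + (if i + j + 1 = m then \<epsilon> else 0)) / 2)"

lemma reflection_proj_carrier [simp]: "reflection_proj m \<epsilon> \<in> carrier_mat m m"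
  by (simp add: reflection_proj_def)

lemma mult_reflection_proj:
  assumes A: "A \<in> carrier_mat k m" and "i < k" "j < m"
  shows "(A * reflection_proj m \<epsilon>) $$ (i, j) = (A $$ (i, j) + \<epsilon> * A $$ (i, m - 1 - j)) / 2"
proof -
  have "(A * reflection_proj m \<epsilon>) $$ (i, j)
      = (\<Sum>l<m. (if l = j then A $$ (i, l) / 2 else 0) +
               (if l = m - 1 - j then \<epsilon> * A $$ (i, l) / 2 else 0))"
    unfolding index_mult_mat_sum[OF A reflection_proj_carrier assms(2,3)]
    by (rule sum.cong) (use assms in \<open>auto simp: reflection_proj_def field_simps\<close>)
  also have "\<dots> = A $$ (i, j) / 2 + \<epsilon> * A $$ (i, m - 1 - j) / 2"
    using assms by (simp add: sum.distrib)
  finally show ?thesis by (simp add: add_divide_distrib)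
qed

lemma reflection_proj_mult:
  assumes A: "A \<in> carrier_mat m k" and "i < m" "j < k"
  shows "(reflection_proj m \<epsilon> * A) $$ (i, j) = (A $$ (i, j) + \<epsilon> * A $$ (m - 1 - i, j)) / 2"
proof -
  have "(reflection_proj m \<epsilon> * A) $$ (i, j)
      = (\<Sum>l<m. (if l = i then A $$ (l, j) / 2 else 0) +
               (if l = m - 1 - i then \<epsilon> * A $$ (l, j) / 2 else 0))"
    unfolding index_mult_mat_sum[OF reflection_proj_carrier A assms(2,3)]
    by (rule sum.cong) (use assms in \<open>auto simp: reflection_proj_def field_simps\<close>)
  also have "\<dots> = A $$ (i, j) / 2 + \<epsilon> * A $$ (m - 1 - i, j) / 2"
    using assms by (simp add: sum.distrib)
  finally show ?thesis by (simp add: add_divide_distrib)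
qed

lemma reflection_proj_idem:
  assumes "\<epsilon> * \<epsilon> = 1"
  shows "reflection_proj m \<epsilon> * reflection_proj m \<epsilon> = reflection_proj m \<epsilon>"
proof (rule eq_matI)
  fix i j assume "i < dim_row (reflection_proj m \<epsilon>)" "j < dim_col (reflection_proj m \<epsilon>)"
  then have ij: "i < m" "j < m" by (auto simp: reflection_proj_def)
  show "(reflection_proj m \<epsilon> * reflection_proj m \<epsilon>) $$ (i, j) = reflection_proj m \<epsilon> $$ (i, j)"
    unfolding reflection_proj_mult[OF reflection_proj_carrier ij]
    using ij assms by (auto simp: reflection_proj_def field_simps)
qed (auto simp: reflection_proj_def)

lemma balanced_matD:
  assumes "balanced_mat m P" "i < m" "j < m"
  shows "P $$ (i, j) = P $$ (m - 1 - i, m - 1 - j)"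
  using assms unfolding balanced_mat_def by blast

lemma reflection_proj_commute:
  assumes "balanced_mat m P"
  shows "P * reflection_proj m \<epsilon> = reflection_proj m \<epsilon> * P"
proof (rule eq_matI)
  have P: "P \<in> carrier_mat m m" using assms by (simp add: balanced_mat_def)
  fix i j assume "i < dim_row (reflection_proj m \<epsilon> * P)" "j < dim_col (reflection_proj m \<epsilon> * P)"
  then have ij: "i < m" "j < m" using P by (auto simp: reflection_proj_def)
  have "P $$ (i, m - 1 - j) = P $$ (m - 1 - i, m - 1 - (m - 1 - j))"
    using ij by (intro balanced_matD[OF assms]) auto
  then show "(P * reflection_proj m \<epsilon>) $$ (i, j) = (reflection_proj m \<epsilon> * P) $$ (i, j)"
    unfolding reflection_proj_mult[OF P ij] mult_reflection_proj[OF P ij] using ij by simp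
qed (use assms in \<open>auto simp: balanced_mat_def reflection_proj_def\<close>)

text \<open>Row \<open>m - 1 - i\<close> of the projection is \<open>\<epsilon>\<close> times row \<open>i\<close>, so the first \<open>n\<close> rows determine
  it: they form \<open>Y\<close>, and \<open>X\<close> selects the appropriate one with its sign.\<close>

lemma reflection_proj_factor:
  assumes "m \<le> 2 * n" "n \<le> m" "\<epsilon> * \<epsilon> = 1"
  obtains X Y where "X \<in> carrier_mat m n" "Y \<in> carrier_mat n m" "reflection_proj m \<epsilon> = X * Y"
proof
  let ?Q = "reflection_proj m \<epsilon>"
  let ?X = "mat m n (\<lambda>(i, j). if i < n then (if i = j then 1 else 0)
                              else (if m - 1 - i = j then \<epsilon> else 0))"
  let ?Y = "mat n m (\<lambda>(i, j). ?Q $$ (i, j))"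
  show X: "?X \<in> carrier_mat m n" and Y: "?Y \<in> carrier_mat n m" by auto
  show "?Q = ?X * ?Y"
  proof (rule eq_matI)
    fix i j assume "i < dim_row (?X * ?Y)" "j < dim_col (?X * ?Y)"
    then have ij: "i < m" "j < m" by auto
    let ?r = "if i < n then i else m - 1 - i" and ?c = "if i < n then 1 else \<epsilon>"
    have r: "?r < n" using ij assms by auto
    have "(?X * ?Y) $$ (i, j) = (\<Sum>l<n. if ?r = l then ?c * ?Q $$ (l, j) else 0)"
      unfolding index_mult_mat_sum[OF X Y ij]
      by (rule sum.cong) (use ij in auto)
    also have "\<dots> = ?c * ?Q $$ (?r, j)" using r by (subst sum.delta') auto
    also have "\<dots> = ?Q $$ (i, j)" using ij assms by (auto simp: reflection_proj_def)
    finally show "?Q $$ (i, j) = (?X * ?Y) $$ (i, j)" ..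
  qed (auto simp: reflection_proj_def)
qed

lemma trace_mult_reflection_proj:
  assumes "A \<in> carrier_mat m m"
  shows "trace_mat (A * reflection_proj m \<epsilon>) =
    ((\<Sum>i<m. A $$ (i, i)) + \<epsilon> * (\<Sum>i<m. A $$ (i, m - 1 - i))) / 2"
  using assms
  by (simp add: trace_mat_def mult_reflection_proj[OF assms] sum.distrib sum_distrib_left
      flip: sum_divide_distrib del: index_mult_mat(1))

text \<open>The sums over the two diagonals of \<open>P\<^sup>k\<close> together encode the traces of \<open>P\<^sup>k\<close> on the
  symmetric and on the antisymmetric vectors, and these two spaces span everything.\<close>

lemma balanced_nilpotent_if_diagonals_zero:
  assumes bal: "balanced_mat m P" and mn: "m \<le> 2 * n" "n \<le> m"
    and diag: "\<And>k. k \<in> {1..n} \<Longrightarrow> (\<Sum>i<m. (P ^\<^sub>m k) $$ (i, i)) = 0"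
    and anti: "\<And>k. k \<in> {1..n} \<Longrightarrow> (\<Sum>i<m. (P ^\<^sub>m k) $$ (i, m - 1 - i)) = 0"
  shows "P ^\<^sub>m n = 0\<^sub>m m m"
proof -
  have P: "P \<in> carrier_mat m m" using bal by (simp add: balanced_mat_def)
  have Pk: "P ^\<^sub>m k \<in> carrier_mat m m" for k using P by simp
  have zero: "P ^\<^sub>m n * reflection_proj m \<epsilon> = 0\<^sub>m m m" if \<epsilon>: "\<epsilon> * \<epsilon> = 1" for \<epsilon>
  proof -
    obtain X Y where "X \<in> carrier_mat m n" "Y \<in> carrier_mat n m" "reflection_proj m \<epsilon> = X * Y"
      using reflection_proj_factor[OF mn \<epsilon>] by blast
    then show ?thesis
      by (rule pow_mult_zero_if_compressed_traces_zero[OF P _ _ _ reflection_proj_idem[OF \<epsilon>]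
            reflection_proj_commute[OF bal]])
        (simp only: trace_mult_reflection_proj[OF Pk] diag anti mult_zero_right add_0 div_0)
  qed
  show ?thesis
  proof (rule eq_matI)
    fix i j assume "i < dim_row (0\<^sub>m m m :: real mat)" "j < dim_col (0\<^sub>m m m :: real mat)"
    then have ij: "i < m" "j < m" by auto
    have "((P ^\<^sub>m n) $$ (i, j) + \<epsilon> * (P ^\<^sub>m n) $$ (i, m - 1 - j)) / 2 = 0" if "\<epsilon> * \<epsilon> = 1" for \<epsilon>
      using mult_reflection_proj[OF Pk ij, of n \<epsilon>] zero[OF that] ij by simp
    \<comment> \<open>The projections for \<open>\<epsilon> = 1\<close> and \<open>\<epsilon> = - 1\<close> add up to the identity.\<close>
    from this[of 1] this[of "-1"] show "(P ^\<^sub>m n) $$ (i, j) = 0\<^sub>m m m $$ (i, j)" using ij by simp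
  qed (use P in auto)
qed

section \<open>Removing the constant part of a magic square\<close>

abbreviation ones_mat :: "nat \<Rightarrow> real mat" where
  "ones_mat m \<equiv> mat m m (\<lambda>_. 1)"

text \<open>As \<open>P = M - w J\<close> kills \<open>J\<close> and \<open>J M\<close> is a multiple of \<open>J\<close>, each multiplication by \<open>P\<close> only
  changes the multiple of \<open>J\<close> that is subtracted from the power of \<open>M\<close>. Comparing row sums
  identifies that multiple with the weight of the power.\<close>

lemma semimagic_deflate_pow:
  assumes "m > 0" "N > 0" and M: "semimagic_square m w M" and MN: "semimagic_square m v (M ^\<^sub>m N)"
  shows "(M - w \<cdot>\<^sub>m ones_mat m) ^\<^sub>m N = M ^\<^sub>m N - v \<cdot>\<^sub>m ones_mat m"
proof -
  let ?J = "ones_mat m"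
  define P where "P = M - w \<cdot>\<^sub>m ?J"
  have J: "?J \<in> carrier_mat m m" by simp
  have MC: "M \<in> carrier_mat m m" using M by (simp add: semimagic_square_def)
  have P: "P \<in> carrier_mat m m" by (simp add: P_def minus_carrier_mat)
  have Pk: "P ^\<^sub>m k \<in> carrier_mat m m" and Mk: "M ^\<^sub>m k \<in> carrier_mat m m" for k
    using P MC by auto
  have rowP: "(\<Sum>j<m. P $$ (i, j)) = 0" if "i < m" for i
    using that M MC by (simp add: P_def sum_subtractf semimagic_square_def)
  have PJ: "P * ?J = 0\<^sub>m m m"
    by (rule eq_matI)
      (use P rowP in \<open>auto simp: index_mult_mat_sum[OF P J] simp del: index_mult_mat(1)\<close>)
  have JM: "?J * M = (real m * w) \<cdot>\<^sub>m ?J"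
    by (rule eq_matI)
      (use M MC in \<open>auto simp: index_mult_mat_sum[OF J MC] semimagic_square_def simp del: index_mult_mat(1)\<close>)
  have PkJ: "P ^\<^sub>m Suc k * ?J = 0\<^sub>m m m" for k
    using assoc_mult_mat[OF Pk P J, of k] PJ right_mult_zero_mat[OF Pk, of k m] by simp
  have "\<exists>c. P ^\<^sub>m Suc k = M ^\<^sub>m Suc k - c \<cdot>\<^sub>m ?J" for k
  proof (induction k)
    case 0
    show ?case using P MC by (auto simp: P_def intro!: exI[of _ w])
  next
    case (Suc k)
    then obtain c where c: "P ^\<^sub>m Suc k = M ^\<^sub>m Suc k - c \<cdot>\<^sub>m ?J" by blast
    let ?R = "P ^\<^sub>m Suc k"
    have R: "?R \<in> carrier_mat m m" by (rule Pk)
    have cJ: "c \<cdot>\<^sub>m ?J \<in> carrier_mat m m" for c by simp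
    have "P ^\<^sub>m Suc (Suc k) = ?R * (M - w \<cdot>\<^sub>m ?J)" by (simp add: P_def)
    also have "\<dots> = ?R * M - w \<cdot>\<^sub>m (?R * ?J)"
      using mult_minus_distrib_mat[OF R MC cJ] mult_smult_distrib[OF R J] by simp
    also have "\<dots> = ?R * M"
      unfolding PkJ by (rule eq_matI) (use R MC in auto)
    also have "\<dots> = M ^\<^sub>m Suc k * M - c \<cdot>\<^sub>m (?J * M)"
      unfolding c using minus_mult_distrib_mat[OF Mk[of "Suc k"] cJ MC] mult_smult_assoc_mat[OF J MC] by simp
    also have "\<dots> = M ^\<^sub>m Suc (Suc k) - (c * (real m * w)) \<cdot>\<^sub>m ?J"
      unfolding JM by (rule eq_matI) auto
    finally show ?case by blast
  qed
  from this[of "N - 1"] obtain c where c: "P ^\<^sub>m N = M ^\<^sub>m N - c \<cdot>\<^sub>m ?J" using \<open>N > 0\<close> by auto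
  \<comment> \<open>An entry of \<open>P\<^sup>N J = 0\<close> is a row sum of \<open>P\<^sup>N\<close>.\<close>
  have "0 = (P ^\<^sub>m N * ?J) $$ (0, 0)" using PkJ[of "N - 1"] \<open>N > 0\<close> \<open>m > 0\<close> by simp
  also have "\<dots> = (\<Sum>l<m. (M ^\<^sub>m N) $$ (0, l)) - real m * c"
    using \<open>m > 0\<close> Mk[of N] index_mult_mat_sum[OF Pk J, of 0 0 N]
    by (simp add: c sum_subtractf del: index_mult_mat(1))
  also have "\<dots> = real m * (v - c)"
    using MN \<open>m > 0\<close> by (simp add: semimagic_square_def algebra_simps)
  finally have "c = v" using \<open>m > 0\<close> by simp
  then show ?thesis using c by (simp add: P_def)
qed

theorem theorem6:
  fixes n m :: nat and M :: "real mat"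
  assumes "n \<ge> 1"
    and "m = 2 * n \<or> m = 2 * n - 1"
    and "magic_square m M"
    and "balanced_mat m M"
  shows "\<exists>N\<in>{1..n}. trivial_magic_square m (M ^\<^sub>m N) \<or> \<not> magic_square m (M ^\<^sub>m N)"
proof (rule ccontr)
  assume "\<not> ?thesis"
  then have magic: "magic_square m (M ^\<^sub>m N)" and nontrivial: "\<not> trivial_magic_square m (M ^\<^sub>m N)"
    if "N \<in> {1..n}" for N using that by blast+
  have mn: "m > 0" "m \<le> 2 * n" "n \<le> m" using assms(1,2) by auto
  obtain w where w: "semimagic_square m w M"
    using assms(3) by (auto simp: magic_square_def magic_square_of_weight_def)
  have MC: "M \<in> carrier_mat m m" using w by (simp add: semimagic_square_def)
  define P where "P = M - w \<cdot>\<^sub>m ones_mat m"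
  have bal: "balanced_mat m P"
    unfolding balanced_mat_def
  proof (intro conjI allI impI)
    fix i j assume ij: "i < m" "j < m"
    then have "M $$ (i, j) = M $$ (m - 1 - i, m - 1 - j)"
      by (rule balanced_matD[OF assms(4)])
    then show "P $$ (i, j) = P $$ (m - 1 - i, m - 1 - j)"
      using ij MC by (simp add: P_def)
  qed (simp add: P_def minus_carrier_mat)
  have deflate: "\<exists>v. magic_square_of_weight m v (M ^\<^sub>m N) \<and> P ^\<^sub>m N = M ^\<^sub>m N - v \<cdot>\<^sub>m ones_mat m"
    if "N \<in> {1..n}" for N
    using magic[OF that] semimagic_deflate_pow[OF mn(1) _ w, of N] that
    by (fastforce simp: magic_square_def magic_square_of_weight_def P_def)
  have "P ^\<^sub>m n = 0\<^sub>m m m"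
  proof (rule balanced_nilpotent_if_diagonals_zero[OF bal mn(2,3)])
    fix k assume "k \<in> {1..n}"
    then obtain v where v: "magic_square_of_weight m v (M ^\<^sub>m k)"
      and Pk: "P ^\<^sub>m k = M ^\<^sub>m k - v \<cdot>\<^sub>m ones_mat m" using deflate by blast
    show "(\<Sum>i<m. (P ^\<^sub>m k) $$ (i, i)) = 0" "(\<Sum>i<m. (P ^\<^sub>m k) $$ (i, m - 1 - i)) = 0"
      using v MC by (auto simp: Pk magic_square_of_weight_def sum_subtractf)
  qed
  moreover obtain v where "P ^\<^sub>m n = M ^\<^sub>m n - v \<cdot>\<^sub>m ones_mat m" using deflate[of n] assms(1) by auto
  ultimately have eq: "M ^\<^sub>m n - v \<cdot>\<^sub>m ones_mat m = 0\<^sub>m m m" by simp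
  have "M ^\<^sub>m n = v \<cdot>\<^sub>m ones_mat m"
  proof (rule eq_matI)
    fix i j assume "i < dim_row (v \<cdot>\<^sub>m ones_mat m)" "j < dim_col (v \<cdot>\<^sub>m ones_mat m)"
    then show "(M ^\<^sub>m n) $$ (i, j) = (v \<cdot>\<^sub>m ones_mat m) $$ (i, j)"
      using arg_cong[OF eq, of "\<lambda>A. A $$ (i, j)"] MC by simp
  qed (use MC in auto)
  then show False
    using magic[of n] nontrivial[of n] assms(1) by (auto simp: trivial_magic_square_def)
qed

end
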